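(* Let $\mathbb{F}$ be any field and $n\ge3$. Let $S_n$ be the anticommutative algebra over $\mathbb{F}$ with basis $\{e_1,\dots,e_n\}$ defined by the relations $[e_i,e_{i+1}]=e_{i+2}$ for $1\le i\le n-2$, $[e_{n-1},e_n]=e_1$ and $[e_n,e_1]=e_2$. Let $A_{n+1}=\mathbb{F}d\ltimes S_n$ be the anticommutative algebra extending $S_n$ by one basis vector $d$ with $[d,e_1]=e_2$. Then $A_{n+1}$ is a simple Hom-Lie algebra with respect to the twisting map $\sigma$ defined by $\sigma(d)=\sigma(e_i)=0$ for $1\le i\le n-1$ and $\sigma(e_n)=d$.
   Context: An anticommutative algebra is a vector space with a bilinear product $[\cdot,\cdot]$ satisfying $[x,x]=0$ for all $x$. Products of basis vectors that are not listed (and not determined from the listed ones by antisymmetry) are zero; in particular $[d,e_i]=0$ for $2\le i\le n$. A Hom-Lie algebra is a triple $(A,[\cdot,\cdot],\sigma)$ with $A$ an anticommutative algebra and $\sigma:A\to A$ linear (a twisting map) with $[\sigma(x),[y,z]]+[\sigma(y),[z,x]]+[\sigma(z),[x,y]]=0$ for all $x,y,z\in A$. A Hom-ideal is a subspace $I$ with $[I,A]\subset I$ and $\sigma(I)\subset I$; a Hom-Lie algebra is simple if its product is nonzero and its only Hom-ideals are $0$ and $A$. *)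

theory Defs
  imports Complex_Main
begin

locale anticommutative_algebra = vector_space scale
  for scale :: "'k::field \<Rightarrow> 'v::ab_group_add \<Rightarrow> 'v" +
  fixes br :: "'v \<Rightarrow> 'v \<Rightarrow> 'v"
  assumes br_linear_left: "Vector_Spaces.linear scale scale (\<lambda>x. br x y)"
    and br_linear_right: "Vector_Spaces.linear scale scale (\<lambda>y. br x y)"
    and br_self: "br x x = 0"

locale hom_lie_algebra = anticommutative_algebra scale br
  for scale :: "'k::field \<Rightarrow> 'v::ab_group_add \<Rightarrow> 'v"
    and br :: "'v \<Rightarrow> 'v \<Rightarrow> 'v" +
  fixes \<sigma> :: "'v \<Rightarrow> 'v"
  assumes twist_linear: "Vector_Spaces.linear scale scale \<sigma>"
    and hom_jacobi: "br (\<sigma> x) (br y z) + br (\<sigma> y) (br z x) + br (\<sigma> z) (br x y) = 0"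
begin

definition hom_ideal :: "'v set \<Rightarrow> bool" where
  "hom_ideal I \<longleftrightarrow> subspace I \<and> (\<forall>x\<in>I. \<forall>a. br x a \<in> I) \<and> \<sigma> ` I \<subseteq> I"

end

locale simple_hom_lie_algebra = hom_lie_algebra scale br \<sigma>
  for scale :: "'k::field \<Rightarrow> 'v::ab_group_add \<Rightarrow> 'v"
    and br :: "'v \<Rightarrow> 'v \<Rightarrow> 'v" and \<sigma> :: "'v \<Rightarrow> 'v" +
  assumes br_nonzero: "\<exists>x y. br x y \<noteq> 0"
    and hom_ideal_trivial: "hom_ideal I \<Longrightarrow> I = {0} \<or> I = UNIV"

text \<open>The multiplication table of \<open>S\<^sub>n\<close> on \<open>e 1, \<dots>, e n\<close>; values of \<open>e\<close> at other arguments are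
  irrelevant. The last clause lists the pairs \<open>i < j\<close> that occur, in either order, in none of the
  defining relations.\<close>

definition S_relations :: "('v::ab_group_add \<Rightarrow> 'v \<Rightarrow> 'v) \<Rightarrow> nat \<Rightarrow> (nat \<Rightarrow> 'v) \<Rightarrow> bool" where
  "S_relations br n e \<longleftrightarrow>
     (\<forall>i. 1 \<le> i \<and> i \<le> n - 2 \<longrightarrow> br (e i) (e (i + 1)) = e (i + 2)) \<and>
     br (e (n - 1)) (e n) = e 1 \<and>
     br (e n) (e 1) = e 2 \<and>
     (\<forall>i j. 1 \<le> i \<and> i < j \<and> j \<le> n \<and> j \<noteq> i + 1 \<and> (i, j) \<noteq> (1, n) \<longrightarrow> br (e i) (e j) = 0)"

text \<open>The algebra \<open>A\<^bsub>n+1\<^esub>\<close> is the whole type \<open>'v\<close>, presented by a basis \<open>d, e 1, \<dots>, e n\<close>; the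
  subalgebra \<open>S\<^sub>n\<close> is the span of \<open>e 1, \<dots>, e n\<close>.\<close>

locale A_algebra = anticommutative_algebra scale br
  for scale :: "'k::field \<Rightarrow> 'v::ab_group_add \<Rightarrow> 'v"
    and br :: "'v \<Rightarrow> 'v \<Rightarrow> 'v" +
  fixes n :: nat and d :: 'v and e :: "nat \<Rightarrow> 'v"
  assumes e_inj: "inj_on e {1..n}"
    and d_notin: "d \<notin> e ` {1..n}"
    and basis_independent: "independent (insert d (e ` {1..n}))"
    and basis_span: "span (insert d (e ` {1..n})) = UNIV"
    and e_relations: "S_relations br n e"
    and d_e1: "br d (e 1) = e 2"
    and d_e: "2 \<le> i \<Longrightarrow> i \<le> n \<Longrightarrow> br d (e i) = 0"

text \<open>The relations are consistent: over every field, each vector space with a basis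
  \<open>d, e 1, \<dots>, e n\<close>, \<open>n \<ge> 3\<close>, carries such a product and the twisting map considered with it.\<close>

lemma (in vector_space) A_algebra_exists:
  assumes n: "n \<ge> 3" and inj: "inj_on e {1..n}" and d: "d \<notin> e ` {1..n}"
    and ind: "independent (insert d (e ` {1..n}))"
    and sp: "span (insert d (e ` {1..n})) = UNIV"
  shows "\<exists>br. A_algebra scale br n d e"
    and "\<exists>\<sigma>. Vector_Spaces.linear scale scale \<sigma> \<and> \<sigma> d = 0 \<and>
           (\<forall>i. 1 \<le> i \<and> i \<le> n - 1 \<longrightarrow> \<sigma> (e i) = 0) \<and> \<sigma> (e n) = d"
proof -
  define B where "B = insert d (e ` {1..n})"
  define b where "b i = (if i = 0 then d else e i)" for i :: nat
  define r where "r x i = representation B x (b i)" for x i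
  have ind': "independent B" and sp': "x \<in> span B" for x
    using ind sp by (auto simp: B_def)
  have bB: "b i \<in> B" if "i \<le> n" for i
    using that by (auto simp: b_def B_def)
  have b_eq: "b i = b j \<longleftrightarrow> i = j" if "i \<le> n" "j \<le> n" for i j
    using that d inj_on_eq_iff[OF inj, of i j] by (auto simp: b_def)
  have r_add: "r (x + y) i = r x i + r y i" for x y i
    using representation_add[OF ind' sp' sp'] by (simp add: r_def)
  have r_scale: "r (scale c x) i = c * r x i" for c x i
    using representation_scale[OF ind' sp'] by (simp add: r_def)
  have r_b: "r (b k) i = (if i = k then 1 else 0)" if "k \<le> n" "i \<le> n" for k i
    using representation_basis[OF ind' bB[OF that(1)]] b_eq[OF that] by (auto simp: r_def)
  have lin: "Vector_Spaces.linear scale scale f"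
    if "\<And>x y. f (x + y) = f x + f y" "\<And>c x. f (scale c x) = scale c (f x)" for f
    using that vector_space_axioms
    by (simp add: Vector_Spaces.linear_def module_hom_def module_hom_axioms_def
        module_axioms)
  define t where "t i j =
     (if i = 0 \<and> j = 1 \<or> i = n \<and> j = 1 then e 2
      else if 1 \<le> i \<and> i \<le> n - 2 \<and> j = i + 1 then e (i + 2)
      else if i = n - 1 \<and> j = n then e 1 else 0)" for i j :: nat
  define br where "br x y =
     (\<Sum>i\<le>n. \<Sum>j\<le>n. scale (r x i * r y j - r x j * r y i) (t i j))" for x y
  have br_add_left: "br (x + x') y = br x y + br x' y" for x x' y
  proof -
    have "r (x + x') i * r y j - r (x + x') j * r y i =
        (r x i * r y j - r x j * r y i) + (r x' i * r y j - r x' j * r y i)" for i j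
      by (simp add: r_add ring_distribs)
    then show ?thesis by (simp only: br_def scale_left_distrib sum.distrib)
  qed
  have br_scale_left: "br (scale c x) y = scale c (br x y)" for c x y
  proof -
    have "r (scale c x) i * r y j - r (scale c x) j * r y i =
        c * (r x i * r y j - r x j * r y i)" for i j
      by (simp add: r_scale right_diff_distrib)
    then show ?thesis by (simp add: br_def scale_sum_right)
  qed
  have br_minus: "br x y = - br y x" for x y
    by (simp add: br_def sum_negf[symmetric] scale_minus_left[symmetric] mult.commute
        del: scale_minus_left)
  have br_b: "br (b k) (b l) = t k l - t l k" if kl: "k \<le> n" "l \<le> n" for k l
  proof -
    have "br (b k) (b l) = (\<Sum>i\<le>n. \<Sum>j\<le>n.
        (if i = k then if j = l then t i j else 0 else 0)
        - (if j = k then if i = l then t i j else 0 else 0))"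
      unfolding br_def
      by (intro sum.cong refl) (simp add: r_b kl)
    also have "\<dots> = (\<Sum>i\<le>n. (if i = k then t i l else 0) - (if i = l then t i k else 0))"
    proof (intro sum.cong refl)
      fix i assume "i \<in> {..n}"
      show "(\<Sum>j\<le>n. (if i = k then if j = l then t i j else 0 else 0)
        - (if j = k then if i = l then t i j else 0 else 0)) =
         (if i = k then t i l else 0) - (if i = l then t i k else 0)"
        using kl by (cases "i = k"; cases "i = l") (simp_all add: sum_subtractf sum_negf)
    qed
    also have "\<dots> = t k l - t l k"
      using kl by (simp add: sum_subtractf)
    finally show ?thesis .
  qed
  have br_e: "br (e k) (e l) = t k l - t l k" if "1 \<le> k" "k \<le> n" "1 \<le> l" "l \<le> n" for k l
    using br_b[of k l] that by (simp add: b_def)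
  have br_d: "br d (e l) = t 0 l - t l 0" if "1 \<le> l" "l \<le> n" for l
    using br_b[of 0 l] that by (simp add: b_def)
  have "anticommutative_algebra scale br"
  proof (intro anticommutative_algebra.intro anticommutative_algebra_axioms.intro
      vector_space_axioms)
    show "Vector_Spaces.linear scale scale (\<lambda>x. br x y)" for y
      by (rule lin) (simp_all add: br_add_left br_scale_left)
    show "Vector_Spaces.linear scale scale (\<lambda>y. br x y)" for x
      by (rule lin) (simp_all add: br_minus[of x] br_add_left br_scale_left)
    show "br x x = 0" for x by (simp add: br_def mult.commute)
  qed
  moreover have "S_relations br n e"
    using n by (auto simp: S_relations_def br_e t_def)
  moreover have "br d (e 1) = e 2" "\<And>i. 2 \<le> i \<Longrightarrow> i \<le> n \<Longrightarrow> br d (e i) = 0"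
    using n by (auto simp: br_d t_def)
  ultimately have "A_algebra scale br n d e"
    using inj d ind sp by (intro A_algebra.intro A_algebra_axioms.intro)
  then show "\<exists>br. A_algebra scale br n d e" by blast
  have "r d n = 0"
    using r_b[of 0 n] n by (simp add: b_def)
  moreover have "r (e i) n = (if i = n then 1 else 0)" if "1 \<le> i" "i \<le> n" for i
    using r_b[of i n] that by (auto simp: b_def)
  ultimately show "\<exists>\<sigma>. Vector_Spaces.linear scale scale \<sigma> \<and> \<sigma> d = 0 \<and>
      (\<forall>i. 1 \<le> i \<and> i \<le> n - 1 \<longrightarrow> \<sigma> (e i) = 0) \<and> \<sigma> (e n) = d"
    using n by (intro exI[of _ "\<lambda>x. scale (r x n) d"] conjI lin)
      (auto simp: r_add r_scale scale_left_distrib)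
qed

end

theory Submission
  imports Defs
begin

text \<open>A nonzero element of a Hom-ideal, with top basis vector \<open>e k\<close>, forces a basis vector into the
  ideal: apply \<open>\<sigma>\<close> if \<open>k = n\<close>, multiply by \<open>e n\<close> and then by \<open>d\<close> if \<open>k = n - 1\<close>, and multiply by
  \<open>e (k + 1)\<close> otherwise; an element without \<open>e\<close>-coordinates is a multiple of \<open>d\<close>. Any single basis
  vector generates the others: \<open>[d, e 1] = e 2\<close>, the product walks along \<open>e 2, e 3, \<dots>, e n, e 1\<close>,
  and \<open>\<sigma> (e n) = d\<close>. The Hom-Jacobi identity holds because \<open>\<sigma>\<close> only sees the \<open>e n\<close>-coordinate and
  \<open>[d, [y, z]]\<close> vanishes when \<open>y\<close> and \<open>z\<close> have none.\<close>

section \<open>Bilinear calculus of an anticommutative product\<close>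

context anticommutative_algebra
begin

lemma br_add_left: "br (x + x') y = br x y + br x' y"
  and br_scale_left: "br (scale c x) y = scale c (br x y)"
  and br_add_right: "br x (y + y') = br x y + br x y'"
  and br_scale_right: "br x (scale c y) = scale c (br x y)"
  and br_zero_left: "br 0 y = 0"
  and br_zero_right: "br x 0 = 0"
proof -
  interpret l: Vector_Spaces.linear scale scale "\<lambda>x. br x y" for y by (rule br_linear_left)
  interpret r: Vector_Spaces.linear scale scale "\<lambda>y. br x y" for x by (rule br_linear_right)
  show "br (x + x') y = br x y + br x' y" by (rule l.add)
  show "br (scale c x) y = scale c (br x y)" by (rule l.scale)
  show "br x (y + y') = br x y + br x y'" by (rule r.add)
  show "br x (scale c y) = scale c (br x y)" by (rule r.scale)
  show "br 0 y = 0" by (rule l.zero)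
  show "br x 0 = 0" by (rule r.zero)
qed

lemma br_anticomm: "br y x = - br x y"
proof -
  have "br (x + y) (x + y) = br x y + br y x"
    unfolding br_add_left br_add_right by (simp add: br_self)
  then show ?thesis by (simp add: br_self eq_neg_iff_add_eq_0 add.commute)
qed

lemma br_minus_right: "br x (- y) = - br x y"
  using br_scale_right[of x "-1" y] by simp

lemma br_diff_right: "br x (y - z) = br x y - br x z"
  using br_add_right[of x y "- z"] by (simp add: br_minus_right)

text \<open>Together with the next two lemmas, this lets span induction reduce the vanishing of a
  product to basis vectors, one argument at a time.\<close>

lemma subspace_br_left_kernel: "subspace {y. br y z = 0}"
  by (auto simp: subspace_def br_add_left br_scale_left br_zero_left)

lemma subspace_br_br_left_kernel: "subspace {y. br x (br y z) = 0}"
  by (auto simp: subspace_def br_add_left br_scale_left br_zero_left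
      br_add_right br_scale_right br_zero_right)

lemma subspace_br_br_right_kernel: "subspace {z. br x (br y z) = 0}"
  by (auto simp: subspace_def br_add_right br_scale_right br_zero_right)

end

lemma (in vector_space) in_span_insert_decompose:
  assumes "x \<in> span (insert a S)"
  obtains c y where "x = scale c a + y" "y \<in> span S"
  using assms unfolding span_breakdown_eq by (metis add.commute diff_add_cancel)

lemma (in vector_space) subspace_scale_cancel:
  assumes "subspace I" "scale c x \<in> I" "c \<noteq> 0"
  shows "x \<in> I"
  using subspace_scale[OF assms(1,2), of "inverse c"] assms(3) by simp

section \<open>Multiplication table and products along the flag\<close>

context A_algebra
begin

lemma br_e_Suc: "1 \<le> i \<Longrightarrow> i + 2 \<le> n \<Longrightarrow> br (e i) (e (Suc i)) = e (i + 2)"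
  using e_relations unfolding S_relations_def by auto

lemma br_e_last: "br (e (n - 1)) (e n) = e 1"
  and br_e_n_e_1: "br (e n) (e 1) = e 2"
  using e_relations unfolding S_relations_def by auto

lemma br_e_far: "1 \<le> i \<Longrightarrow> Suc i < j \<Longrightarrow> j \<le> n \<Longrightarrow> (i, j) \<noteq> (1, n) \<Longrightarrow> br (e i) (e j) = 0"
  using e_relations unfolding S_relations_def by auto

text \<open>The filtration starts at the line through \<open>d\<close> (\<open>k = 0\<close>) and
  reaches the whole space at \<open>k = n\<close>; stage \<open>n - 1\<close> is the kernel of the
  twisting map.\<close>

abbreviation flag :: "nat \<Rightarrow> 'v set" where
  "flag k \<equiv> span (insert d (e ` {1..k}))"

lemma flag_Suc: "flag (Suc k) = span (insert (e (Suc k)) (insert d (e ` {1..k})))"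
  by (simp add: atLeastAtMostSuc_conv insert_commute)

text \<open>Among the \<open>e\<close> vectors, \<open>d\<close> moves only \<open>e 1\<close>, and
  \<open>e 1\<close> arises only as a product with \<open>e n\<close>; below index \<open>n\<close>
  the products are \<open>0\<close> or some \<open>e (i + 2)\<close>.\<close>

lemma br_d_br_e_e:
  assumes "1 \<le> i" "i < j" "j < n"
  shows "br d (br (e i) (e j)) = 0"
proof (cases "j = Suc i")
  case True
  then show ?thesis using assms by (simp add: br_e_Suc d_e)
next
  case False
  then show ?thesis using assms by (simp add: br_e_far br_zero_right)
qed

lemma br_d_br_d_e:
  assumes "1 \<le> i" "i < n"
  shows "br d (br d (e i)) = 0"
  using assms by (cases "i = 1") (simp_all add: d_e1 d_e br_zero_right del: One_nat_def)

lemma br_d_br_flag: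
  assumes y: "y \<in> flag (n - 1)" and z: "z \<in> flag (n - 1)"
  shows "br d (br y z) = 0"
proof -
  let ?B = "insert d (e ` {1..n - 1})"
  have basis: "br d (br a b) = 0" if ab: "a \<in> ?B" "b \<in> ?B" for a b
  proof -
    have swap: "br d (br v u) = 0" if "br d (br u v) = 0" for u v
      using that br_anticomm[of u v] by (simp add: br_minus_right)
    have ee: "br d (br (e i) (e j)) = 0" if "i \<in> {1..n - 1}" "j \<in> {1..n - 1}" for i j
    proof (cases i j rule: linorder_cases)
      case less
      then show ?thesis using that by (intro br_d_br_e_e) auto
    next
      case equal
      then show ?thesis by (simp add: br_self br_zero_right)
    next
      case greater
      then show ?thesis using that by (intro swap[OF br_d_br_e_e]) auto
    qed
    have de: "br d (br d (e i)) = 0" if "i \<in> {1..n - 1}" for i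
      using that by (intro br_d_br_d_e) auto
    have dd: "br d (br d d) = 0" by (simp add: br_self br_zero_right)
    consider "a = d" "b = d" | i where "a = d" "b = e i" "i \<in> {1..n - 1}"
      | i where "a = e i" "b = d" "i \<in> {1..n - 1}"
      | i j where "a = e i" "b = e j" "i \<in> {1..n - 1}" "j \<in> {1..n - 1}"
      using ab by (elim insertE imageE) blast+
    then show ?thesis by cases (simp_all only: dd ee de swap[OF de])
  qed
  have "br d (br y b) = 0" if "b \<in> ?B" for b
    by (rule span_induct[OF y subspace_br_br_left_kernel]) (rule basis[OF _ that])
  then show ?thesis by (rule span_induct[OF z subspace_br_br_right_kernel])
qed

text \<open>The index \<open>k + 2\<close> is not adjacent to any index up to \<open>k\<close>, and
  \<open>k + 2 < n\<close> rules out the wrap-around pair \<open>(1, n)\<close>.\<close>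

lemma br_flag_e:
  assumes y: "y \<in> flag k" and k: "k + 2 < n"
  shows "br y (e (k + 2)) = 0"
  by (rule span_induct[OF y subspace_br_left_kernel])
    (use k in \<open>auto simp: d_e br_e_far\<close>)

text \<open>Stage \<open>n - 2\<close> omits \<open>e (n - 1)\<close>, the only basis vector whose
  product with \<open>e n\<close> is \<open>e 1\<close>. The wrap-around product of
  \<open>e 1\<close> and \<open>e n\<close> is a multiple of \<open>e 2\<close>, which
  \<open>d\<close> kills.\<close>

lemma br_d_br_flag_e_n:
  assumes y: "y \<in> flag (n - 2)" and n: "n \<ge> 3"
  shows "br d (br y (e n)) = 0"
proof -
  have "br d (br (e i) (e n)) = 0" if "1 \<le> i" "i \<le> n - 2" for i
  proof (cases "i = 1")
    case True
    have "br (e 1) (e n) = - e 2" using br_anticomm[of "e 1" "e n"] by (simp only: br_e_n_e_1)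
    then show ?thesis using True n by (simp add: br_minus_right d_e)
  next
    case False
    then show ?thesis using that n by (simp add: br_e_far br_zero_right)
  qed
  moreover have "br d (br d (e n)) = 0" using n by (simp add: d_e br_zero_right)
  ultimately show ?thesis
    by (intro span_induct[OF y subspace_br_br_left_kernel, of d "e n"]) auto
qed

lemma e_2_nonzero:
  assumes "n \<ge> 3"
  shows "e 2 \<noteq> 0"
proof -
  have "e 2 \<in> insert d (e ` {1..n})" using assms by simp
  then show ?thesis using basis_independent dependent_zero by metis
qed

end

section \<open>The twisting map and the Hom-Jacobi identity\<close>

locale twisted_A_algebra = A_algebra scale br n d e
  for scale :: "'k::field \<Rightarrow> 'v::ab_group_add \<Rightarrow> 'v" and br n d e +
  fixes \<sigma> :: "'v \<Rightarrow> 'v"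
  assumes n_ge_3: "n \<ge> 3"
    and twist_lin: "Vector_Spaces.linear scale scale \<sigma>"
    and twist_d: "\<sigma> d = 0"
    and twist_e: "1 \<le> i \<Longrightarrow> i \<le> n - 1 \<Longrightarrow> \<sigma> (e i) = 0"
    and twist_e_n: "\<sigma> (e n) = d"
begin

lemma twist_flag: "y \<in> flag (n - 1) \<Longrightarrow> \<sigma> y = 0"
proof -
  interpret \<sigma>: Vector_Spaces.linear scale scale \<sigma> by (rule twist_lin)
  show "y \<in> flag (n - 1) \<Longrightarrow> \<sigma> y = 0"
    by (rule \<sigma>.eq_0_on_span) (auto simp: twist_d twist_e)
qed

lemma twist_decompose: "y \<in> flag (n - 1) \<Longrightarrow> \<sigma> (scale c (e n) + y) = scale c d"
proof -
  interpret \<sigma>: Vector_Spaces.linear scale scale \<sigma> by (rule twist_lin)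
  show "y \<in> flag (n - 1) \<Longrightarrow> \<sigma> (scale c (e n) + y) = scale c d"
    by (simp add: \<sigma>.add \<sigma>.scale twist_flag twist_e_n)
qed

lemma decompose:
  obtains c y where "x = scale c (e n) + y" "y \<in> flag (n - 1)"
proof -
  have "x \<in> flag (Suc (n - 1))" using basis_span n_ge_3 by simp
  then show thesis
    unfolding flag_Suc using n_ge_3 that by (auto elim: in_span_insert_decompose)
qed

lemma br_d_br_decompose:
  assumes "y \<in> flag (n - 1)" "z \<in> flag (n - 1)"
  shows "br d (br (scale b (e n) + y) (scale c (e n) + z)) =
    scale c (br d (br y (e n))) - scale b (br d (br z (e n)))"
proof -
  have "br (scale b (e n) + y) (scale c (e n) + z) =
      br y (scale c (e n)) - br z (scale b (e n)) + br y z"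
    by (simp add: br_add_left br_add_right br_scale_left br_scale_right br_self
        br_anticomm[of "e n" z])
  then show ?thesis
    by (simp only: br_add_right br_diff_right br_scale_right br_d_br_flag[OF assms] add_0_right)
qed

text \<open>With \<open>f u = br d (br u (e n))\<close>, the three terms are
  \<open>a (c f y' - b f z')\<close>, \<open>b (a f z' - c f x')\<close> and
  \<open>c (b f x' - a f y')\<close>, whose sum cancels.\<close>

lemma hom_jacobi_twist: "br (\<sigma> x) (br y z) + br (\<sigma> y) (br z x) + br (\<sigma> z) (br x y) = 0"
proof -
  obtain a x' where x: "x = scale a (e n) + x'" "x' \<in> flag (n - 1)" by (rule decompose)
  obtain b y' where y: "y = scale b (e n) + y'" "y' \<in> flag (n - 1)" by (rule decompose)
  obtain c z' where z: "z = scale c (e n) + z'" "z' \<in> flag (n - 1)" by (rule decompose)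
  show ?thesis
    unfolding x(1) y(1) z(1)
    using x(2) y(2) z(2)
    by (simp add: twist_decompose br_scale_left br_d_br_decompose scale_right_diff_distrib
        mult.commute)
qed

sublocale hom_lie_algebra scale br \<sigma>
  by (intro hom_lie_algebra.intro hom_lie_algebra_axioms.intro anticommutative_algebra_axioms
      twist_lin hom_jacobi_twist)

section \<open>Hom-ideals containing a basis vector\<close>

lemma hom_ideal_memD:
  assumes "hom_ideal I" "x \<in> I"
  shows "br x a \<in> I" "br a x \<in> I" "\<sigma> x \<in> I"
  using assms subspace_neg[of I "br x a"] br_anticomm[of a x]
  by (auto simp: hom_ideal_def)

text \<open>Multiplying \<open>e k\<close> by \<open>e (k - 1)\<close> gives
  \<open>e (k + 1)\<close>; starting at \<open>i = 2\<close> or above keeps the index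
  \<open>k - 1\<close> positive.\<close>

lemma hom_ideal_e_mono:
  assumes I: "hom_ideal I" and ei: "e i \<in> I" and i: "2 \<le> i" and k: "i \<le> k" "k \<le> n"
  shows "e k \<in> I"
  using k
proof (induction k rule: dec_induct)
  case base
  show ?case by (rule ei)
next
  case (step k)
  then have "br (e (k - 1)) (e k) = e (Suc k)" using br_e_Suc[of "k - 1"] i by simp
  then show ?case using hom_ideal_memD(2)[OF I step.IH, of "e (k - 1)"] step.prems by simp
qed

lemma hom_ideal_e_2:
  assumes I: "hom_ideal I" and e2: "e 2 \<in> I"
  shows "I = UNIV"
proof -
  note mem = hom_ideal_e_mono[OF I e2 order_refl]
  have en: "e n \<in> I" using mem n_ge_3 by simp
  have "e 1 \<in> I" using hom_ideal_memD(2)[OF I en, of "e (n - 1)"] br_e_last by simp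
  then have "e i \<in> I" if "1 \<le> i" "i \<le> n" for i
    using mem[of i] that by (cases "i = 1") auto
  moreover have "d \<in> I" using hom_ideal_memD(3)[OF I en] twist_e_n by simp
  ultimately have "span (insert d (e ` {1..n})) \<subseteq> I"
    using I by (intro span_minimal) (auto simp: hom_ideal_def)
  then show ?thesis using basis_span by auto
qed

lemma hom_ideal_d:
  assumes "hom_ideal I" "d \<in> I"
  shows "I = UNIV"
  using hom_ideal_e_2[OF assms(1)] hom_ideal_memD(1)[OF assms, of "e 1"] by (simp only: d_e1)

text \<open>The walk only goes upwards, so indices below \<open>i\<close> are reached through
  \<open>e n\<close>: the twist gives \<open>d\<close>, and \<open>d\<close> brings back
  \<open>e 2\<close>.\<close>

lemma hom_ideal_e:
  assumes I: "hom_ideal I" and i: "2 \<le> i" "i \<le> n" and ei: "e i \<in> I"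
  shows "I = UNIV"
proof -
  have "e n \<in> I" by (rule hom_ideal_e_mono[OF I ei i]) simp
  then show ?thesis
    using hom_ideal_d[OF I] hom_ideal_memD(3)[OF I, of "e n"] twist_e_n by simp
qed

text \<open>Induction along the flag: a zero coefficient at \<open>e (Suc k)\<close> drops to the
  stage below, while a nonzero one settles the claim without the induction hypothesis.\<close>

lemma hom_ideal_flag:
  assumes I: "hom_ideal I" and x: "x \<in> I" "x \<noteq> 0"
    and k: "x \<in> flag k" "k \<le> n"
  shows "I = UNIV"
proof -
  have sub: "subspace I" using I by (simp add: hom_ideal_def)
  show ?thesis
    using k
  proof (induction k)
    case 0
    then obtain c where c: "x = scale c d"
      by (auto simp: span_singleton)
    moreover have "c \<noteq> 0" using c x(2) by auto
    ultimately have "d \<in> I" using x(1) sub subspace_scale_cancel by blast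
    then show ?case by (rule hom_ideal_d[OF I])
  next
    case (Suc k)
    obtain c y where xy: "x = scale c (e (Suc k)) + y" and y: "y \<in> flag k"
      using Suc.prems(1) unfolding flag_Suc by (rule in_span_insert_decompose)
    show ?case
    proof (cases "c = 0")
      case True
      then show ?thesis using Suc xy y by simp
    next
      case False
      note cancel = subspace_scale_cancel[OF sub _ False]
      consider "Suc k = n" | "k + 2 = n" | "k + 2 < n" using Suc.prems(2) by linarith
      then show ?thesis
      proof cases
        case 1
        then have "\<sigma> x = scale c d" using twist_decompose[of y c] xy y by auto
        then have "scale c d \<in> I" using hom_ideal_memD(3)[OF I x(1)] by simp
        then show ?thesis by (rule hom_ideal_d[OF I cancel])
      next
        \<comment> \<open>Here \<open>e (Suc k)\<close> is \<open>e (n - 1)\<close>: multiplying by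
          \<open>e n\<close> turns the leading term into \<open>c\<close> times \<open>e 1\<close>,
          and \<open>d\<close> then kills the tail and sends \<open>e 1\<close> to
          \<open>e 2\<close>.\<close>
        case 2
        then have n: "n = Suc (Suc k)" by simp
        have "br d (br y (e n)) = 0" using br_d_br_flag_e_n[OF _ n_ge_3, of y] y n by simp
        moreover have "br (e (Suc k)) (e n) = e 1" using br_e_last n by simp
        ultimately have "br d (br x (e n)) = scale c (e 2)"
          unfolding xy
          by (simp only: br_add_left br_scale_left br_add_right br_scale_right d_e1 add_0_right)
        then have "scale c (e 2) \<in> I"
          using hom_ideal_memD(2)[OF I hom_ideal_memD(1)[OF I x(1)], of d "e n"] by simp
        then show ?thesis by (rule hom_ideal_e_2[OF I cancel])
      next
        \<comment> \<open>The factor \<open>e (k + 2)\<close> annihilates the tail \<open>y\<close>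
          and moves the leading vector \<open>e (k + 1)\<close> to \<open>e (k + 3)\<close>, whose
          index is still at most \<open>n\<close>.\<close>
        case 3
        then have "br x (e (k + 2)) = scale c (e (k + 3))"
          using br_flag_e[OF y 3] br_e_Suc[of "Suc k"] unfolding xy
          by (simp add: br_add_left br_scale_left numeral_3_eq_3)
        then have "scale c (e (k + 3)) \<in> I"
          using hom_ideal_memD(1)[OF I x(1), of "e (k + 2)"] by simp
        then have "e (k + 3) \<in> I" by (rule cancel)
        then show ?thesis using 3 by (intro hom_ideal_e[OF I, of "k + 3"]) auto
      qed
    qed
  qed
qed

lemma simple_twisted: "simple_hom_lie_algebra scale br \<sigma>"
proof unfold_locales
  show "\<exists>x y. br x y \<noteq> 0" using d_e1 e_2_nonzero[OF n_ge_3] by metis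
  show "I = {0} \<or> I = UNIV" if I: "hom_ideal I" for I
  proof (rule disjCI)
    assume "I \<noteq> UNIV"
    then have "x = 0" if "x \<in> I" for x
      using hom_ideal_flag[OF I that, of n] basis_span by blast
    moreover have "0 \<in> I" using I by (simp add: hom_ideal_def subspace_0)
    ultimately show "I = {0}" by blast
  qed
qed

end

theorem proposition6p5:
  fixes scale :: "'k::field \<Rightarrow> 'v::ab_group_add \<Rightarrow> 'v"
    and br :: "'v \<Rightarrow> 'v \<Rightarrow> 'v"
    and n :: nat and d :: 'v and e :: "nat \<Rightarrow> 'v" and \<sigma> :: "'v \<Rightarrow> 'v"
  assumes "n \<ge> 3"
    and "A_algebra scale br n d e"
    and "Vector_Spaces.linear scale scale \<sigma>"
    and "\<sigma> d = 0"
    and "\<And>i. 1 \<le> i \<Longrightarrow> i \<le> n - 1 \<Longrightarrow> \<sigma> (e i) = 0"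
    and "\<sigma> (e n) = d"
  shows "simple_hom_lie_algebra scale br \<sigma>"
proof -
  interpret twisted_A_algebra scale br n d e \<sigma>
    using assms by (intro twisted_A_algebra.intro twisted_A_algebra_axioms.intro)
  show ?thesis by (rule simple_twisted)
qed

end
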